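(* Let $n\ge 1$, $\rho>0$, let $0\le a_1\le\dots\le a_n$ and $0\le b_1\le\dots\le b_n$ be non-decreasing sequences of real numbers, and let $y_1\ge y_2\ge\dots\ge y_n\ge 0$ (the singular values $\sigma_i(Y)$ of a matrix $Y$). For $s\ge 0$ put $$f_i(s)=\min\{b_i,[s-a_i]_+^2\}-\frac{\rho+1}{\rho}(s-y_i)^2+s^2-[s-a_i]_+^2 .$$ Then the individual unconstrained maximizer of $f_i$ is $$s_i=\begin{cases}\dfrac{a_i\rho}{\rho+1}+y_i, & \dfrac{a_i}{\rho+1}+\sqrt{b_i}<y_i,\\[2mm] a_i+\sqrt{b_i}, & \dfrac{a_i+\sqrt{b_i}}{1+\rho}\le y_i\le\dfrac{a_i}{\rho+1}+\sqrt{b_i},\\[2mm] (1+\rho)y_i, & y_i<\dfrac{a_i+\sqrt{b_i}}{1+\rho},\end{cases}$$ and the modified Algorithm 1 (described in the context), initialized with $(s_1,\dots,s_n)$, returns a maximizing vector for the proximal operator problem, i.e. a vector $(\sigma_1,\dots,\sigma_n)$ with $\sigma_1\ge\dots\ge\sigma_n\ge 0$ such that $$\sum_{i=1}^n f_i(\sigma_i)=\max_{z_1\ge z_2\ge\dots\ge z_n\ge 0}\ \sum_{i=1}^n f_i(z_i).$$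
   Context: Notation: $[t]_+=\max\{t,0\}$. A vector $(\sigma_1,\dots,\sigma_n)$ is a valid singular value vector if $\sigma_1\ge\dots\ge\sigma_n\ge 0$. Modified Algorithm 1. Initialization: set $\sigma_i=s_i$ for $i=1,\dots,n$, with $s_i$ as given in the claim. While $(\sigma_1,\dots,\sigma_n)$ is not a valid singular value vector, do the following. Using the local extrema of the current sequence, form the subintervals $\iota\subseteq\{1,\dots,n\}$ on which the current sequence goes in a non-decreasing way from one local extremum to the next; that is, $\iota=\{p,p+1,\dots,q\}$ with $p<q$ ranges over all maximal sets of consecutive indices with $\sigma_p\le\sigma_{p+1}\le\dots\le\sigma_q$. For each such subinterval $\iota$, choose a scalar $s^*\in\arg\max_{s\ge 0}\sum_{i\in\iota}f_i(s)$ and set $\sigma_i=s^*$ for all $i\in\iota$. Entries not in any such subinterval are left unchanged. When the loop stops, output $(\sigma_1,\dots,\sigma_n)$. *)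

theory Defs
  imports Complex_Main
begin

(* Vectors (x_1, ..., x_n) are functions nat => real restricted to {1..n};
   values outside {1..n} carry no meaning. *)

definition valid_sv :: "nat \<Rightarrow> (nat \<Rightarrow> real) \<Rightarrow> bool" where
  "valid_sv n \<sigma> \<longleftrightarrow> antimono_on {1..n} \<sigma> \<and> (\<forall>i\<in>{1..n}. 0 \<le> \<sigma> i)"

definition pos_part :: "real \<Rightarrow> real" where
  "pos_part t = max t 0"

definition prox_summand :: "real \<Rightarrow> real \<Rightarrow> real \<Rightarrow> real \<Rightarrow> real \<Rightarrow> real" where
  "prox_summand \<rho> a b y s =
     min b ((pos_part (s - a))\<^sup>2) - (\<rho> + 1) / \<rho> * (s - y)\<^sup>2 + s\<^sup>2 - (pos_part (s - a))\<^sup>2"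

definition indiv_maximizer :: "real \<Rightarrow> real \<Rightarrow> real \<Rightarrow> real \<Rightarrow> real" where
  "indiv_maximizer \<rho> a b y =
     (if a / (\<rho> + 1) + sqrt b < y then a * \<rho> / (\<rho> + 1) + y
      else if (a + sqrt b) / (1 + \<rho>) \<le> y \<and> y \<le> a / (\<rho> + 1) + sqrt b then a + sqrt b
      else (1 + \<rho>) * y)"

definition nondecreasing_runs :: "nat \<Rightarrow> (nat \<Rightarrow> real) \<Rightarrow> nat set set" where
  "nondecreasing_runs n \<sigma> =
     {\<iota>. \<exists>p q. 1 \<le> p \<and> p < q \<and> q \<le> n \<and> \<iota> = {p..q} \<and> mono_on {p..q} \<sigma>}"

definition maximal_runs :: "nat \<Rightarrow> (nat \<Rightarrow> real) \<Rightarrow> nat set set" where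
  "maximal_runs n \<sigma> =
     {\<iota> \<in> nondecreasing_runs n \<sigma>. \<forall>\<kappa>\<in>nondecreasing_runs n \<sigma>. \<iota> \<subseteq> \<kappa> \<longrightarrow> \<kappa> = \<iota>}"

(* One pass through the loop body; a relation because the scalar is an arbitrary element
   of the argmax.  If the argmax over some run is empty, there is no successor. *)
definition alg_step ::
  "nat \<Rightarrow> (nat \<Rightarrow> real \<Rightarrow> real) \<Rightarrow> (nat \<Rightarrow> real) \<Rightarrow> (nat \<Rightarrow> real) \<Rightarrow> bool" where
  "alg_step n f \<sigma> \<sigma>' \<longleftrightarrow>
     \<not> valid_sv n \<sigma> \<and>
     (\<forall>\<iota>\<in>maximal_runs n \<sigma>. \<exists>s.
        is_arg_max (\<lambda>t. \<Sum>i\<in>\<iota>. f i t) (\<lambda>t. 0 \<le> t) s \<and> (\<forall>i\<in>\<iota>. \<sigma>' i = s)) \<and>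
     (\<forall>i. i \<notin> \<Union> (maximal_runs n \<sigma>) \<longrightarrow> \<sigma>' i = \<sigma> i)"

definition alg_reaches ::
  "nat \<Rightarrow> (nat \<Rightarrow> real \<Rightarrow> real) \<Rightarrow> (nat \<Rightarrow> real) \<Rightarrow> (nat \<Rightarrow> real) \<Rightarrow> bool" where
  "alg_reaches n f = (alg_step n f)\<^sup>*\<^sup>*"

(* No infinite execution, and no execution gets stuck before the loop condition fails. *)
definition alg_terminates :: "nat \<Rightarrow> (nat \<Rightarrow> real \<Rightarrow> real) \<Rightarrow> (nat \<Rightarrow> real) \<Rightarrow> bool" where
  "alg_terminates n f \<sigma>0 \<longleftrightarrow>
     \<not> (\<exists>X. X 0 = \<sigma>0 \<and> (\<forall>k. alg_step n f (X k) (X (Suc k)))) \<and>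
     (\<forall>\<sigma>. alg_reaches n f \<sigma>0 \<sigma> \<and> \<not> valid_sv n \<sigma> \<longrightarrow> (\<exists>\<sigma>'. alg_step n f \<sigma> \<sigma>'))"

definition alg_output ::
  "nat \<Rightarrow> (nat \<Rightarrow> real \<Rightarrow> real) \<Rightarrow> (nat \<Rightarrow> real) \<Rightarrow> (nat \<Rightarrow> real) \<Rightarrow> bool" where
  "alg_output n f \<sigma>0 \<sigma> \<longleftrightarrow> alg_reaches n f \<sigma>0 \<sigma> \<and> valid_sv n \<sigma>"

end

(* Every f_i is strictly concave on [0, \<infinity>): up to the kink a_i + sqrt b_i it is one concave
   quadratic, beyond it another, with a smaller slope at the kink; the three cases of s_i record
   which vertex, or the kink, is the peak. Only concavity matters for the algorithm, which is
   then the pool-adjacent-violators scheme: prefixes of a pooled block never gain from being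
   raised, suffixes never from being lowered. A merge preserves this, and a valid sequence with
   this property is optimal. Each pass removes a strict ascent and splits no block, so the
   number of indices at which the sequence changes value decreases. *)

theory Submission
  imports Defs "HOL-Analysis.Convex"
begin

text \<open>For differentiable summands, optimality under an ordering constraint is a sign condition
  on partial sums of derivatives over blocks. Here the summands have a kink, and a maximizer may sit
  exactly on it. The condition is therefore phrased as monotonicity of partial sums on
  \<open>{v..}\<close> and on \<open>{0..v}\<close>; concavity turns any argmax into such
  monotonicity, so neither derivatives nor uniqueness of the pooled maximizer enter.

  The two halves of the invariant cannot be carried separately: after pooling, a prefix sum is the
  total minus a suffix sum and vice versa, so each half is re-established from both old halves. A
  pass pools several old blocks of a run at once, and its new value may lie anywhere relative to the
  old ones; the monotonicity is therefore obtained in two pieces, meeting at the old value at the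
  cut.\<close>

section \<open>The individual summands\<close>

text \<open>Up to the kink the minimum is the square itself and cancels against the subtracted one.
  This includes \<open>t < a\<close>, where both vanish, so \<open>a\<close> is not a breakpoint and
  two branches suffice.\<close>

lemma prox_summand_below:
  assumes "0 \<le> b" "t \<le> a + sqrt b"
  shows "prox_summand \<rho> a b y t = t\<^sup>2 - (\<rho> + 1) / \<rho> * (t - y)\<^sup>2"
proof -
  have "pos_part (t - a) \<le> sqrt b" "0 \<le> pos_part (t - a)"
    using assms by (auto simp: pos_part_def)
  then have "(pos_part (t - a))\<^sup>2 \<le> (sqrt b)\<^sup>2"
    by (intro power_mono)
  then show ?thesis
    using assms by (simp add: prox_summand_def min_def)
qed

lemma prox_summand_above:
  assumes "0 \<le> b" "a + sqrt b \<le> t"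
  shows "prox_summand \<rho> a b y t = b + t\<^sup>2 - (t - a)\<^sup>2 - (\<rho> + 1) / \<rho> * (t - y)\<^sup>2"
proof -
  have ge: "sqrt b \<le> t - a" "0 \<le> sqrt b" using assms by auto
  then have "(sqrt b)\<^sup>2 \<le> (t - a)\<^sup>2"
    by (intro power_mono)
  moreover have "pos_part (t - a) = t - a"
    using order_trans[OF ge(2,1)] by (simp add: pos_part_def)
  ultimately show ?thesis
    using assms by (simp add: prox_summand_def min_def)
qed

lemma strict_mono_on_combine:
  fixes f :: "real \<Rightarrow> real"
  assumes "\<And>x y. l \<le> x \<Longrightarrow> x < y \<Longrightarrow> y \<le> m \<Longrightarrow> f x < f y"
    and "\<And>x y. m \<le> x \<Longrightarrow> x < y \<Longrightarrow> y \<le> u \<Longrightarrow> f x < f y"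
    and "l \<le> x" "x < y" "y \<le> u"
  shows "f x < f y"
proof -
  consider "y \<le> m" | "m \<le> x" | "x < m" "m < y" by linarith
  then show ?thesis
  proof cases
    case 3
    then have "f x < f m" "f m < f y" using assms by auto
    then show ?thesis by simp
  qed (use assms in auto)
qed

text \<open>The last factor is twice the signed distance from the midpoint of the arguments to the
  vertex of the branch, which gives the monotonicity on either side of the vertex.\<close>

lemma below_branch_diff:
  fixes \<rho> :: real
  assumes "\<rho> > 0"
  shows "(u\<^sup>2 - (\<rho> + 1) / \<rho> * (u - y)\<^sup>2) - (t\<^sup>2 - (\<rho> + 1) / \<rho> * (t - y)\<^sup>2)
    = (u - t) * (2 * ((1 + \<rho>) * y) - t - u) / \<rho>"
proof -
  \<comment> \<open>With \<open>k\<close> all quotients disappear and the identity is polynomial;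
    \<open>- k\<close> is the leading coefficient of the quadratic.\<close>
  define k where "k = 1 / \<rho>"
  have "(\<rho> + 1) / \<rho> = 1 + k" "(1 + \<rho>) / \<rho> = 1 + k"
    using assms by (simp_all add: k_def field_simps)
  moreover have "(u - t) * (2 * ((1 + \<rho>) * y) - t - u) / \<rho>
      = (u - t) * (2 * ((1 + \<rho>) / \<rho> * y) - k * (t + u))"
    by (simp add: k_def diff_divide_distrib add_divide_distrib algebra_simps)
  ultimately show ?thesis
    by (simp add: algebra_simps power2_eq_square)
qed

lemma above_branch_diff:
  fixes \<rho> :: real
  assumes "\<rho> > 0"
  shows "(b + u\<^sup>2 - (u - a)\<^sup>2 - (\<rho> + 1) / \<rho> * (u - y)\<^sup>2)
       - (b + t\<^sup>2 - (t - a)\<^sup>2 - (\<rho> + 1) / \<rho> * (t - y)\<^sup>2)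
    = (\<rho> + 1) / \<rho> * ((u - t) * (2 * (a * \<rho> / (\<rho> + 1) + y) - t - u))"
proof -
  \<comment> \<open>\<open>w\<close> is the offset of the vertex from \<open>y\<close>. Since
    \<open>w\<close> contains \<open>a\<close>, it has to be folded before \<open>a\<close> is
    replaced by \<open>K * w\<close>; the result is a polynomial identity.\<close>
  define K w where "K = (\<rho> + 1) / \<rho>" and "w = a * \<rho> / (\<rho> + 1)"
  have a: "a = K * w" using assms by (simp add: K_def w_def)
  show ?thesis
    unfolding K_def[symmetric] w_def[symmetric]
    unfolding a
    by (simp add: algebra_simps power2_eq_square)
qed

context
  fixes \<rho> a b y :: real
  assumes \<rho>: "\<rho> > 0" and a: "0 \<le> a" and b: "0 \<le> b" and y: "0 \<le> y"
begin

lemma prox_summand_below_less: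
  assumes "t < u" "u \<le> a + sqrt b" "u \<le> (1 + \<rho>) * y"
  shows "prox_summand \<rho> a b y t < prox_summand \<rho> a b y u"
proof -
  have "0 < (u - t) * (2 * ((1 + \<rho>) * y) - t - u) / \<rho>"
    using assms \<rho> by (intro divide_pos_pos mult_pos_pos) auto
  then show ?thesis
    using assms b below_branch_diff[OF \<rho>, of u y t]
    by (simp add: prox_summand_below)
qed

lemma prox_summand_below_greater:
  assumes "t < u" "u \<le> a + sqrt b" "(1 + \<rho>) * y \<le> t"
  shows "prox_summand \<rho> a b y u < prox_summand \<rho> a b y t"
proof -
  have "(u - t) * (2 * ((1 + \<rho>) * y) - t - u) / \<rho> < 0"
    using assms \<rho> by (intro divide_neg_pos mult_pos_neg) auto
  then show ?thesis
    using assms b below_branch_diff[OF \<rho>, of u y t]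
    by (simp add: prox_summand_below)
qed

lemma prox_summand_above_less:
  assumes "t < u" "a + sqrt b \<le> t" "u \<le> a * \<rho> / (\<rho> + 1) + y"
  shows "prox_summand \<rho> a b y t < prox_summand \<rho> a b y u"
proof -
  have "0 < (\<rho> + 1) / \<rho> * ((u - t) * (2 * (a * \<rho> / (\<rho> + 1) + y) - t - u))"
    using assms \<rho> by (intro divide_pos_pos mult_pos_pos) auto
  then show ?thesis
    using assms b above_branch_diff[OF \<rho>, of b u a y t]
    by (simp add: prox_summand_above)
qed

lemma prox_summand_above_greater:
  assumes "t < u" "a + sqrt b \<le> t" "a * \<rho> / (\<rho> + 1) + y \<le> t"
  shows "prox_summand \<rho> a b y u < prox_summand \<rho> a b y t"
proof -
  have "(\<rho> + 1) / \<rho> * ((u - t) * (2 * (a * \<rho> / (\<rho> + 1) + y) - t - u)) < 0"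
    using assms \<rho> by (intro mult_pos_neg divide_pos_pos) auto
  then show ?thesis
    using assms b above_branch_diff[OF \<rho>, of b u a y t]
    by (simp add: prox_summand_above)
qed

text \<open>In this form, comparing the upper vertex with the kink amounts, after cancelling
  \<open>a\<close>, to the first case condition on \<open>y\<close> in
  \<open>indiv_maximizer\<close>.\<close>

lemma vertex_above_eq: "a * \<rho> / (\<rho> + 1) + y = a + y - a / (\<rho> + 1)"
  using \<rho> by (simp add: field_simps)

lemma kink_le_vertex_below_iff: "(a + sqrt b) / (1 + \<rho>) \<le> y \<longleftrightarrow> a + sqrt b \<le> (1 + \<rho>) * y"
  using \<rho> by (simp add: pos_divide_le_eq mult.commute)

text \<open>The slack \<open>\<rho> * sqrt b\<close> is the gap between the two thresholds for
  \<open>y\<close>, up to the factor \<open>1 + \<rho>\<close>. Hence if the upper branch still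
  rises at the kink, the lower branch rises all the way to it.\<close>

lemma kink_le_vertex_below:
  assumes "a / (\<rho> + 1) + sqrt b \<le> y"
  shows "a + sqrt b \<le> (1 + \<rho>) * y"
proof -
  have "(1 + \<rho>) * (a / (\<rho> + 1) + sqrt b) \<le> (1 + \<rho>) * y"
    using assms \<rho> by (intro mult_left_mono) auto
  moreover have "(1 + \<rho>) * (a / (\<rho> + 1) + sqrt b) = a + sqrt b + \<rho> * sqrt b"
    using \<rho> by (simp add: field_simps)
  moreover have "0 \<le> \<rho> * sqrt b" using \<rho> b by simp
  ultimately show ?thesis by linarith
qed

text \<open>Each case records where both vertices lie relative to the kink, which is what the
  monotonicity proofs consume. In the middle case neither vertex lies strictly inside the range of
  its own branch.\<close>

lemma indiv_maximizer_cases: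
  obtains (above) "indiv_maximizer \<rho> a b y = a * \<rho> / (\<rho> + 1) + y"
      "a + sqrt b \<le> a * \<rho> / (\<rho> + 1) + y" "a + sqrt b \<le> (1 + \<rho>) * y"
  | (kink) "indiv_maximizer \<rho> a b y = a + sqrt b"
      "a * \<rho> / (\<rho> + 1) + y \<le> a + sqrt b" "a + sqrt b \<le> (1 + \<rho>) * y"
  | (below) "indiv_maximizer \<rho> a b y = (1 + \<rho>) * y"
      "a * \<rho> / (\<rho> + 1) + y \<le> a + sqrt b" "(1 + \<rho>) * y \<le> a + sqrt b"
proof -
  consider "a / (\<rho> + 1) + sqrt b < y"
    | "y \<le> a / (\<rho> + 1) + sqrt b" "(a + sqrt b) / (1 + \<rho>) \<le> y"
    | "y \<le> a / (\<rho> + 1) + sqrt b" "y < (a + sqrt b) / (1 + \<rho>)"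
    by linarith
  then show thesis
  proof cases
    case 1
    then have "a + sqrt b \<le> a * \<rho> / (\<rho> + 1) + y"
      unfolding vertex_above_eq by linarith
    with 1 show ?thesis
      using above kink_le_vertex_below by (simp add: indiv_maximizer_def)
  next
    case 2
    then have "a * \<rho> / (\<rho> + 1) + y \<le> a + sqrt b"
      unfolding vertex_above_eq by linarith
    with 2 show ?thesis
      using kink kink_le_vertex_below_iff by (simp add: indiv_maximizer_def)
  next
    case 3
    then have "a * \<rho> / (\<rho> + 1) + y \<le> a + sqrt b"
      unfolding vertex_above_eq by linarith
    with 3 show ?thesis
      using below kink_le_vertex_below_iff by (simp add: indiv_maximizer_def)
  qed
qed

lemma indiv_maximizer_nonneg: "0 \<le> indiv_maximizer \<rho> a b y"
  using \<rho> a b y by (simp add: indiv_maximizer_def)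

lemma prox_summand_strictly_increasing:
  assumes "t < u" "u \<le> indiv_maximizer \<rho> a b y"
  shows "prox_summand \<rho> a b y t < prox_summand \<rho> a b y u"
proof (cases rule: indiv_maximizer_cases)
  \<comment> \<open>Only here can \<open>t\<close> and \<open>u\<close> straddle the kink; in the
    other two cases \<open>u\<close> is at most the kink and the lower branch alone decides.\<close>
  case above
  have "prox_summand \<rho> a b y x < prox_summand \<rho> a b y z"
    if "t \<le> x" "x < z" "z \<le> a + sqrt b" for x z
    by (rule prox_summand_below_less) (use that above in simp_all)
  moreover have "prox_summand \<rho> a b y x < prox_summand \<rho> a b y z"
    if "a + sqrt b \<le> x" "x < z" "z \<le> u" for x z
    by (rule prox_summand_above_less) (use that above assms in simp_all)
  ultimately show ?thesis
    by (rule strict_mono_on_combine[where f = "prox_summand \<rho> a b y", OF _ _ order_refl assms(1) order_refl])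
next
  case kink
  show ?thesis by (rule prox_summand_below_less) (use assms kink in simp_all)
next
  case below
  show ?thesis by (rule prox_summand_below_less) (use assms below in simp_all)
qed

lemma prox_summand_strictly_decreasing:
  assumes "t < u" "indiv_maximizer \<rho> a b y \<le> t"
  shows "prox_summand \<rho> a b y u < prox_summand \<rho> a b y t"
proof (cases rule: indiv_maximizer_cases)
  \<comment> \<open>The straddling case on the falling side; negation makes the gluing lemma for
    increasing functions applicable.\<close>
  case below
  have "- prox_summand \<rho> a b y x < - prox_summand \<rho> a b y z"
    if "t \<le> x" "x < z" "z \<le> a + sqrt b" for x z
    using prox_summand_below_greater[of x z] that below assms by simp
  moreover have "- prox_summand \<rho> a b y x < - prox_summand \<rho> a b y z"
    if "a + sqrt b \<le> x" "x < z" "z \<le> u" for x z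
    using prox_summand_above_greater[of x z] that below assms by simp
  ultimately have "- prox_summand \<rho> a b y t < - prox_summand \<rho> a b y u"
    by (rule strict_mono_on_combine[where f = "\<lambda>s. - prox_summand \<rho> a b y s", OF _ _ order_refl assms(1) order_refl])
  then show ?thesis by simp
next
  case kink
  show ?thesis by (rule prox_summand_above_greater) (use assms kink in simp_all)
next
  case above
  show ?thesis by (rule prox_summand_above_greater) (use assms above in simp_all)
qed

lemma is_arg_max_prox_summand_iff:
  "is_arg_max (prox_summand \<rho> a b y) (\<lambda>t. 0 \<le> t) t \<longleftrightarrow> t = indiv_maximizer \<rho> a b y"
proof -
  have less: "prox_summand \<rho> a b y t < prox_summand \<rho> a b y (indiv_maximizer \<rho> a b y)"
    if "t \<noteq> indiv_maximizer \<rho> a b y" for t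
    using that prox_summand_strictly_increasing[of t "indiv_maximizer \<rho> a b y"]
      prox_summand_strictly_decreasing[of "indiv_maximizer \<rho> a b y" t]
    by (cases "t < indiv_maximizer \<rho> a b y") auto
  show ?thesis
  proof
    assume "is_arg_max (prox_summand \<rho> a b y) (\<lambda>t. 0 \<le> t) t"
    then show "t = indiv_maximizer \<rho> a b y"
      using less[of t] indiv_maximizer_nonneg by (auto simp: is_arg_max_def)
  next
    assume "t = indiv_maximizer \<rho> a b y"
    then show "is_arg_max (prox_summand \<rho> a b y) (\<lambda>t. 0 \<le> t) t"
      unfolding is_arg_max_linorder using less indiv_maximizer_nonneg
      by (metis less_imp_le order_refl)
  qed
qed

end

section \<open>Concavity and continuity of the summands\<close>

text \<open>The positive part is convex and nonnegative, where squaring is monotone; the square of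
  an average then falls short of the average of the squares by
  \<open>t * (1 - t) * (?X - ?Z)\<^sup>2\<close>.\<close>

lemma convex_on_pos_part_square: "convex_on UNIV (\<lambda>s. (pos_part (s - a))\<^sup>2)"
proof (rule convex_onI)
  fix t x z :: real
  assume t: "0 < t" "t < 1"
  let ?X = "pos_part (x - a)" and ?Z = "pos_part (z - a)"
  have nonneg: "0 \<le> ?X" "0 \<le> ?Z" and ge: "x - a \<le> ?X" "z - a \<le> ?Z"
    by (auto simp: pos_part_def)
  have "(1 - t) * (x - a) + t * (z - a) \<le> (1 - t) * ?X + t * ?Z"
    using t ge by (intro add_mono mult_left_mono) auto
  moreover have "0 \<le> (1 - t) * ?X + t * ?Z"
    using t nonneg by simp
  moreover have "(1 - t) *\<^sub>R x + t *\<^sub>R z - a = (1 - t) * (x - a) + t * (z - a)"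
    by (simp add: algebra_simps)
  ultimately have le: "pos_part ((1 - t) *\<^sub>R x + t *\<^sub>R z - a) \<le> (1 - t) * ?X + t * ?Z"
    by (simp only: pos_part_def max.bounded_iff)
  have "(pos_part ((1 - t) *\<^sub>R x + t *\<^sub>R z - a))\<^sup>2 \<le> ((1 - t) * ?X + t * ?Z)\<^sup>2"
    using le by (intro power_mono) (auto simp: pos_part_def)
  also have "\<dots> = (1 - t) * ?X\<^sup>2 + t * ?Z\<^sup>2 - t * (1 - t) * (?X - ?Z)\<^sup>2"
    by (simp add: algebra_simps power2_eq_square)
  also have "\<dots> \<le> (1 - t) * ?X\<^sup>2 + t * ?Z\<^sup>2"
    using t by simp
  finally show "(pos_part ((1 - t) *\<^sub>R x + t *\<^sub>R z - a))\<^sup>2 \<le> (1 - t) * ?X\<^sup>2 + t * ?Z\<^sup>2" .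
qed simp

text \<open>Moving the subtracted square into the minimum leaves \<open>min (b - ?P s) 0\<close>, a
  minimum of two concave functions, so no case distinction at the kink arises. The remaining
  quadratic has leading coefficient \<open>- 1 / \<rho>\<close>.\<close>

lemma concave_prox_summand:
  assumes "\<rho> > 0" and t: "0 \<le> t" "t \<le> 1"
  shows "(1 - t) * prox_summand \<rho> a b y x + t * prox_summand \<rho> a b y z
    \<le> prox_summand \<rho> a b y ((1 - t) * x + t * z)"
proof -
  let ?q = "\<lambda>s. s\<^sup>2 - (\<rho> + 1) / \<rho> * (s - y)\<^sup>2"
  let ?P = "\<lambda>s. (pos_part (s - a))\<^sup>2"
  have eq: "prox_summand \<rho> a b y s = ?q s + min (b - ?P s) 0" for s
    by (simp add: prox_summand_def min_def)
  have "?P ((1 - t) * x + t * z) \<le> (1 - t) * ?P x + t * ?P z"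
    using convex_onD[OF convex_on_pos_part_square, of t x z a] t by simp
  then have "(1 - t) * (b - ?P x) + t * (b - ?P z) \<le> b - ?P ((1 - t) * x + t * z)"
    by (simp add: algebra_simps)
  moreover have "(1 - t) * min (b - ?P x) 0 + t * min (b - ?P z) 0
      \<le> (1 - t) * (b - ?P x) + t * (b - ?P z)"
    using t by (intro add_mono mult_left_mono) auto
  moreover have "(1 - t) * min (b - ?P x) 0 + t * min (b - ?P z) 0 \<le> 0"
    using t by (simp add: add_nonpos_nonpos mult_nonneg_nonpos)
  ultimately have m: "(1 - t) * min (b - ?P x) 0 + t * min (b - ?P z) 0
      \<le> min (b - ?P ((1 - t) * x + t * z)) 0" by simp
  define k where "k = 1 / \<rho>"
  have k: "(\<rho> + 1) / \<rho> = 1 + k" using assms(1) by (simp add: k_def field_simps)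
  have "?q ((1 - t) * x + t * z) - ((1 - t) * ?q x + t * ?q z) = t * (1 - t) * (x - z)\<^sup>2 * k"
    unfolding k by (simp add: algebra_simps power2_eq_square)
  moreover have "0 \<le> t * (1 - t) * (x - z)\<^sup>2 * k"
    using assms by (simp add: k_def)
  ultimately have "(1 - t) * ?q x + t * ?q z \<le> ?q ((1 - t) * x + t * z)" by linarith
  with m show ?thesis unfolding eq distrib_left by linarith
qed

lemma concave_on_prox_summand: "\<rho> > 0 \<Longrightarrow> concave_on {0..} (prox_summand \<rho> a b y)"
  unfolding concave_on_iff
proof (intro conjI ballI allI impI)
  fix x z u v :: real
  assume "\<rho> > 0" "0 \<le> u" "0 \<le> v" "u + v = 1"
  moreover from this have "u = 1 - v" "v \<le> 1" by simp_all
  ultimately show "u * prox_summand \<rho> a b y x + v * prox_summand \<rho> a b y z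
      \<le> prox_summand \<rho> a b y (u *\<^sub>R x + v *\<^sub>R z)"
    using concave_prox_summand[of \<rho> v a b y x z] by simp
qed simp

lemma continuous_on_prox_summand: "continuous_on S (prox_summand \<rho> a b y)"
  unfolding prox_summand_def pos_part_def by (intro continuous_intros)

section \<open>Pooling for concave summands\<close>

text \<open>Both bounds on \<open>m\<close> admit an empty part, which occurs when a block reaches
  index 1 or index \<open>n\<close>.\<close>

lemma sum_Icc_split:
  fixes g :: "nat \<Rightarrow> 'a::comm_monoid_add"
  assumes "p \<le> Suc m" "m \<le> q"
  shows "sum g {p..q} = sum g {p..m} + sum g {Suc m..q}"
proof -
  have "{p..q} = {p..m} \<union> {Suc m..q}" using assms by auto
  then show ?thesis by (simp add: sum.union_disjoint)
qed

lemma antimono_on_atLeast_combine: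
  fixes f :: "'a::linorder \<Rightarrow> 'b::preorder"
  assumes "antimono_on {l..m} f" "antimono_on {m..} f"
  shows "antimono_on {l..} f"
proof (rule monotone_onI)
  fix x y :: 'a
  assume "x \<in> {l..}" "y \<in> {l..}" "x \<le> y"
  then consider "y \<le> m" "x \<in> {l..m}" "y \<in> {l..m}" | "m \<le> x" "m \<le> y"
    | "x \<in> {l..m}" "m \<in> {l..m}" "x \<le> m" "m \<le> y"
    by fastforce
  then show "f y \<le> f x"
  proof cases
    case 1
    then show ?thesis using monotone_onD[OF assms(1)] \<open>x \<le> y\<close> by blast
  next
    case 2
    then show ?thesis using monotone_onD[OF assms(2), of x y] \<open>x \<le> y\<close> by simp
  next
    case 3
    then have "f y \<le> f m" "f m \<le> f x"
      using monotone_onD[OF assms(1), of x m] monotone_onD[OF assms(2), of m y] by auto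
    then show ?thesis by (rule order_trans)
  qed
qed

lemma mono_on_atLeastAtMost_combine:
  fixes f :: "'a::linorder \<Rightarrow> 'b::preorder"
  assumes "mono_on {l..m} f" "mono_on {m..u} f"
  shows "mono_on {l..u} f"
proof (rule monotone_onI)
  fix x y :: 'a
  assume "x \<in> {l..u}" "y \<in> {l..u}" "x \<le> y"
  then consider "y \<le> m" "x \<in> {l..m}" "y \<in> {l..m}" | "m \<le> x" "x \<in> {m..u}" "y \<in> {m..u}"
    | "x \<in> {l..m}" "m \<in> {l..m}" "x \<le> m" "m \<le> y" "m \<in> {m..u}" "y \<in> {m..u}"
    by fastforce
  then show "f x \<le> f y"
  proof cases
    case 1
    then show ?thesis using monotone_onD[OF assms(1)] \<open>x \<le> y\<close> by blast
  next
    case 2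
    then show ?thesis using monotone_onD[OF assms(2)] \<open>x \<le> y\<close> by blast
  next
    case 3
    then have "f x \<le> f m" "f m \<le> f y"
      using monotone_onD[OF assms(1), of x m] monotone_onD[OF assms(2), of m y] by auto
    then show ?thesis by (rule order_trans)
  qed
qed

text \<open>The chord from \<open>F x\<close> to the larger value \<open>F m\<close> never drops
  below \<open>F x\<close>, and the graph lies above the chord.\<close>

lemma concave_on_ge_segment:
  fixes F :: "real \<Rightarrow> real"
  assumes "concave_on S F" "x \<in> S" "m \<in> S" "F x \<le> F m" "0 \<le> t" "t \<le> 1"
  shows "F x \<le> F ((1 - t) * x + t * m)"
proof -
  have "(1 - t) * F x + t * F m \<le> F ((1 - t) * x + t * m)"
    using concave_onD[OF assms(1), of t x m] assms by simp
  moreover have "t * F x \<le> t * F m" using assms by (intro mult_left_mono)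
  ultimately show ?thesis by (simp add: algebra_simps)
qed

lemma segment_param:
  fixes x z m :: real
  assumes "x \<le> z \<and> z \<le> m \<or> m \<le> z \<and> z \<le> x"
  obtains t where "0 \<le> t" "t \<le> 1" "z = (1 - t) * x + t * m"
proof (cases "x = m")
  case True
  then show ?thesis using that[of 0] assms by simp
next
  case False
  then have "z = (1 - (z - x) / (m - x)) * x + (z - x) / (m - x) * m"
    by (simp add: divide_simps) (simp add: algebra_simps)
  moreover have "0 \<le> (z - x) / (m - x)" "(z - x) / (m - x) \<le> 1"
    using False assms by (auto simp: divide_simps)
  ultimately show ?thesis using that by blast
qed

text \<open>Any point between \<open>x\<close> and \<open>m\<close> is reached by moving from
  \<open>x\<close> towards a maximum. \<open>m\<close> may be any maximizer, so the algorithm's free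
  choice from the argmax does no harm.\<close>

lemma concave_arg_max_unimodal:
  fixes F :: "real \<Rightarrow> real"
  assumes conc: "concave_on {0..} F" and m: "is_arg_max F (\<lambda>t. 0 \<le> t) m"
  shows "mono_on {0..m} F" and "antimono_on {m..} F"
proof -
  have m': "0 \<le> m" and max: "\<And>t. 0 \<le> t \<Longrightarrow> F t \<le> F m"
    using m by (auto simp: is_arg_max_linorder)
  show "mono_on {0..m} F"
  proof (rule monotone_onI)
    fix x z assume xz: "x \<in> {0..m}" "z \<in> {0..m}" "x \<le> z"
    then obtain t where "0 \<le> t" "t \<le> 1" "z = (1 - t) * x + t * m"
      using segment_param[of x z m] by auto
    then show "F x \<le> F z"
      using concave_on_ge_segment[OF conc, of x m t] xz m' max by auto
  qed
  show "antimono_on {m..} F"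
  proof (rule monotone_onI)
    fix z x assume xz: "z \<in> {m..}" "x \<in> {m..}" "z \<le> x"
    then obtain t where "0 \<le> t" "t \<le> 1" "z = (1 - t) * x + t * m"
      using segment_param[of x z m] by auto
    then show "F x \<le> F z"
      using concave_on_ge_segment[OF conc, of x m t] xz m' max by auto
  qed
qed

lemma sum_concave_on:
  fixes f :: "'i \<Rightarrow> real \<Rightarrow> real"
  assumes "convex S" "finite A" "\<And>i. i \<in> A \<Longrightarrow> concave_on S (f i)"
  shows "concave_on S (\<lambda>t. \<Sum>i\<in>A. f i t)"
  using assms(2,3)
  by (induction A rule: finite_induct) (auto simp: concave_on_const assms(1) intro: concave_on_add)

section \<open>Maximal non-decreasing runs\<close>

lemma nondecreasing_runsI:
  "1 \<le> p \<Longrightarrow> p < q \<Longrightarrow> q \<le> n \<Longrightarrow> mono_on {p..q} \<sigma> \<Longrightarrow> {p..q} \<in> nondecreasing_runs n \<sigma>"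
  unfolding nondecreasing_runs_def by blast

text \<open>Without a strict descent at an end, the run could be extended by one index. Strictness
  is essential: it makes both ends boundaries between different values, as the invariant
  demands.\<close>

lemma maximal_runsE:
  assumes "\<iota> \<in> maximal_runs n \<sigma>"
  obtains r e where "1 \<le> r" "r < e" "e \<le> n" "\<iota> = {r..e}" "mono_on {r..e} \<sigma>"
    "r = 1 \<or> \<sigma> r < \<sigma> (r - 1)" "e = n \<or> \<sigma> (Suc e) < \<sigma> e"
proof -
  from assms obtain r e where re: "1 \<le> r" "r < e" "e \<le> n" "\<iota> = {r..e}" "mono_on {r..e} \<sigma>"
    by (auto simp: maximal_runs_def nondecreasing_runs_def)
  have maxi: "\<kappa> = {r..e}" if "\<kappa> \<in> nondecreasing_runs n \<sigma>" "{r..e} \<subseteq> \<kappa>" for \<kappa>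
    using assms re that by (auto simp: maximal_runs_def)
  have "r = 1 \<or> \<sigma> r < \<sigma> (r - 1)"
  proof (rule ccontr)
    assume "\<not> ?thesis"
    then have r: "r - 1 \<ge> 1" "\<sigma> (r - 1) \<le> \<sigma> r" using re by auto
    have "mono_on {r - 1..e} \<sigma>"
    proof (rule monotone_onI)
      fix x z assume xz: "x \<in> {r - 1..e}" "z \<in> {r - 1..e}" "x \<le> z"
      consider "x = z" | "r \<le> x" | "x = r - 1" "r \<le> z" using xz by fastforce
      then show "\<sigma> x \<le> \<sigma> z"
      proof cases
        case 3
        then have "\<sigma> r \<le> \<sigma> z" using mono_onD[OF re(5), of r z] xz re by auto
        then show ?thesis using 3 r by simp
      qed (use mono_onD[OF re(5), of x z] xz in auto)
    qed
    then have "{r - 1..e} \<in> nondecreasing_runs n \<sigma>"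
      using re r by (intro nondecreasing_runsI) auto
    then have "{r - 1..e} = {r..e}" by (rule maxi) auto
    moreover have "r - 1 \<in> {r - 1..e}" "r - 1 \<notin> {r..e}" using re by auto
    ultimately show False by simp
  qed
  moreover have "e = n \<or> \<sigma> (Suc e) < \<sigma> e"
  proof (rule ccontr)
    assume "\<not> ?thesis"
    then have e: "Suc e \<le> n" "\<sigma> e \<le> \<sigma> (Suc e)" using re by auto
    have "mono_on {r..Suc e} \<sigma>"
    proof (rule monotone_onI)
      fix x z assume xz: "x \<in> {r..Suc e}" "z \<in> {r..Suc e}" "x \<le> z"
      consider "x = z" | "z \<le> e" | "z = Suc e" "x \<le> e" using xz by fastforce
      then show "\<sigma> x \<le> \<sigma> z"
      proof cases
        case 3
        then have "\<sigma> x \<le> \<sigma> e" using mono_onD[OF re(5), of x e] xz re by auto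
        then show ?thesis using 3 e by simp
      qed (use mono_onD[OF re(5), of x z] xz in auto)
    qed
    then have "{r..Suc e} \<in> nondecreasing_runs n \<sigma>"
      using re e by (intro nondecreasing_runsI) auto
    then have "{r..Suc e} = {r..e}" by (rule maxi) auto
    moreover have "Suc e \<in> {r..Suc e}" "Suc e \<notin> {r..e}" using re by auto
    ultimately show False by simp
  qed
  ultimately show thesis using re that by blast
qed

text \<open>The pair is itself a run, and a finite family has a maximal member above it. Weak
  ascents are included, so equal neighbours always stay together.\<close>

lemma ascent_in_maximal_run:
  assumes "1 \<le> i" "i < n" "\<sigma> i \<le> \<sigma> (Suc i)"
  obtains \<iota> where "\<iota> \<in> maximal_runs n \<sigma>" "i \<in> \<iota>" "Suc i \<in> \<iota>"
proof -
  have "mono_on {i..Suc i} \<sigma>"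
    using assms by (auto intro!: monotone_onI simp: le_Suc_eq)
  then have "{i..Suc i} \<in> nondecreasing_runs n \<sigma>"
    using assms by (intro nondecreasing_runsI) auto
  moreover have "finite (nondecreasing_runs n \<sigma>)"
    by (rule finite_subset[of _ "Pow {1..n}"]) (auto simp: nondecreasing_runs_def)
  ultimately obtain \<iota> where \<iota>: "\<iota> \<in> nondecreasing_runs n \<sigma>" "{i..Suc i} \<subseteq> \<iota>"
    "\<forall>\<kappa>\<in>nondecreasing_runs n \<sigma>. \<iota> \<subseteq> \<kappa> \<longrightarrow> \<iota> = \<kappa>"
    using finite_has_maximal2 by metis
  then have "\<iota> \<in> maximal_runs n \<sigma>" by (auto simp: maximal_runs_def)
  moreover have "i \<in> \<iota>" "Suc i \<in> \<iota>" using \<iota>(2) by auto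
  ultimately show thesis using that by blast
qed

text \<open>If one run began or ended strictly inside the other, the strict descent at that end
  would contradict the monotonicity of the other. This makes the new value of an index well
  defined.\<close>

lemma maximal_runs_disjoint:
  assumes "\<iota> \<in> maximal_runs n \<sigma>" "\<kappa> \<in> maximal_runs n \<sigma>" "x \<in> \<iota>" "x \<in> \<kappa>"
  shows "\<iota> = \<kappa>"
proof -
  obtain r e where re: "1 \<le> r" "r < e" "e \<le> n" "\<iota> = {r..e}" "mono_on {r..e} \<sigma>"
    "r = 1 \<or> \<sigma> r < \<sigma> (r - 1)" "e = n \<or> \<sigma> (Suc e) < \<sigma> e"
    using assms(1) by (rule maximal_runsE)
  obtain r' e' where re': "1 \<le> r'" "r' < e'" "e' \<le> n" "\<kappa> = {r'..e'}" "mono_on {r'..e'} \<sigma>"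
    "r' = 1 \<or> \<sigma> r' < \<sigma> (r' - 1)" "e' = n \<or> \<sigma> (Suc e') < \<sigma> e'"
    using assms(2) by (rule maximal_runsE)
  have x: "r \<le> x" "x \<le> e" "r' \<le> x" "x \<le> e'" using assms re re' by auto
  have "\<not> r < r'"
  proof
    assume "r < r'"
    then have "\<sigma> (r' - 1) \<le> \<sigma> r'" using x by (intro mono_onD[OF re(5)]) auto
    then show False using re'(6) re(1) \<open>r < r'\<close> by auto
  qed
  moreover have "\<not> r' < r"
  proof
    assume "r' < r"
    then have "\<sigma> (r - 1) \<le> \<sigma> r" using x by (intro mono_onD[OF re'(5)]) auto
    then show False using re(6) re'(1) \<open>r' < r\<close> by auto
  qed
  moreover have "\<not> e < e'"
  proof
    assume "e < e'"
    then have "\<sigma> e \<le> \<sigma> (Suc e)" using x by (intro mono_onD[OF re'(5)]) auto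
    then show False using re(7) re'(3) \<open>e < e'\<close> by auto
  qed
  moreover have "\<not> e' < e"
  proof
    assume "e' < e"
    then have "\<sigma> e' \<le> \<sigma> (Suc e')" using x by (intro mono_onD[OF re(5)]) auto
    then show False using re'(7) re(3) \<open>e' < e\<close> by auto
  qed
  ultimately have "r = r'" "e = e'" by auto
  then show ?thesis using re re' by simp
qed

text \<open>The loop invariant. A prefix of a block of equal values never gains from being raised, and
  a suffix never from being lowered. Stating it for every bound \<open>v\<close> of \<open>\<sigma>\<close> on the
  interval, rather than for the constant value of one block, makes it stable under merging and
  independent of how adjacent blocks that happen to share a value are delimited.\<close>

definition prefix_stable :: "nat \<Rightarrow> (nat \<Rightarrow> real \<Rightarrow> real) \<Rightarrow> (nat \<Rightarrow> real) \<Rightarrow> bool" where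
  "prefix_stable n f \<sigma> \<longleftrightarrow> (\<forall>p q v. 1 \<le> p \<and> p \<le> q \<and> q \<le> n \<and> (p = 1 \<or> \<sigma> (p - 1) \<noteq> \<sigma> p)
     \<and> (\<forall>i\<in>{p..q}. \<sigma> i \<le> v) \<longrightarrow> antimono_on {v..} (\<lambda>t. \<Sum>i=p..q. f i t))"

definition suffix_stable :: "nat \<Rightarrow> (nat \<Rightarrow> real \<Rightarrow> real) \<Rightarrow> (nat \<Rightarrow> real) \<Rightarrow> bool" where
  "suffix_stable n f \<sigma> \<longleftrightarrow> (\<forall>p q v. 1 \<le> p \<and> p \<le> q \<and> q \<le> n \<and> (q = n \<or> \<sigma> (Suc q) \<noteq> \<sigma> q)
     \<and> (\<forall>i\<in>{p..q}. v \<le> \<sigma> i) \<longrightarrow> mono_on {0..v} (\<lambda>t. \<Sum>i=p..q. f i t))"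

lemma prefix_stableD:
  assumes "prefix_stable n f \<sigma>" "1 \<le> p" "p \<le> q" "q \<le> n" "p = 1 \<or> \<sigma> (p - 1) \<noteq> \<sigma> p"
    "\<And>i. p \<le> i \<Longrightarrow> i \<le> q \<Longrightarrow> \<sigma> i \<le> v"
  shows "antimono_on {v..} (\<lambda>t. \<Sum>i=p..q. f i t)"
  using assms unfolding prefix_stable_def by auto

lemma suffix_stableD:
  assumes "suffix_stable n f \<sigma>" "1 \<le> p" "p \<le> q" "q \<le> n" "q = n \<or> \<sigma> (Suc q) \<noteq> \<sigma> q"
    "\<And>i. p \<le> i \<Longrightarrow> i \<le> q \<Longrightarrow> v \<le> \<sigma> i"
  shows "mono_on {0..v} (\<lambda>t. \<Sum>i=p..q. f i t)"
  using assms unfolding suffix_stable_def by auto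

text \<open>Holds termwise: from \<open>v\<close> on, every summand is already past the point where
  it starts to decrease.\<close>

lemma initial_prefix_stable:
  assumes "\<And>i. i \<in> {1..n} \<Longrightarrow> antimono_on {\<sigma> i..} (f i)"
  shows "prefix_stable n f \<sigma>"
  unfolding prefix_stable_def
proof (intro allI impI monotone_onI sum_mono)
  fix p q v i and x y :: real
  assume "1 \<le> p \<and> p \<le> q \<and> q \<le> n \<and> (p = 1 \<or> \<sigma> (p - 1) \<noteq> \<sigma> p) \<and> (\<forall>i\<in>{p..q}. \<sigma> i \<le> v)"
    and "x \<in> {v..}" "y \<in> {v..}" "x \<le> y" "i \<in> {p..q}"
  then have "i \<in> {1..n}" "\<sigma> i \<le> x" "x \<le> y" by force+
  then show "f i y \<le> f i x"
    using monotone_onD[OF assms, of i x y] by simp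
qed

lemma initial_suffix_stable:
  assumes "\<And>i. i \<in> {1..n} \<Longrightarrow> mono_on {0..\<sigma> i} (f i)"
  shows "suffix_stable n f \<sigma>"
  unfolding suffix_stable_def
proof (intro allI impI monotone_onI sum_mono)
  fix p q v i and x y :: real
  assume "1 \<le> p \<and> p \<le> q \<and> q \<le> n \<and> (q = n \<or> \<sigma> (Suc q) \<noteq> \<sigma> q) \<and> (\<forall>i\<in>{p..q}. v \<le> \<sigma> i)"
    and "x \<in> {0..v}" "y \<in> {0..v}" "x \<le> y" "i \<in> {p..q}"
  then have "i \<in> {1..n}" "0 \<le> x" "y \<le> \<sigma> i" "x \<le> y" by force+
  then show "f i x \<le> f i y"
    using monotone_onD[OF assms, of i x y] by simp
qed

section \<open>Preservation of the invariant by one pass\<close>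

text \<open>From \<open>\<sigma> q\<close> upwards the old prefix condition applies, because
  \<open>\<sigma> q\<close> is the largest old value on the prefix. Between \<open>s\<close> and
  \<open>\<sigma> q\<close> the total decreases, while the rest of the run increases by the old
  suffix condition; their difference, the prefix sum, decreases.\<close>

lemma pooled_prefix_antimono:
  assumes pre: "prefix_stable n f \<sigma>" and suf: "suffix_stable n f \<sigma>"
    and re: "1 \<le> r" "r \<le> q" "q \<le> e" "e \<le> n" "mono_on {r..e} \<sigma>"
    and ends: "r = 1 \<or> \<sigma> (r - 1) \<noteq> \<sigma> r" "e = n \<or> \<sigma> (Suc e) \<noteq> \<sigma> e"
    and s: "0 \<le> s" "antimono_on {s..} (\<lambda>t. \<Sum>i=r..e. f i t)"
  shows "antimono_on {s..} (\<lambda>t. \<Sum>i=r..q. f i t)"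
proof -
  have mono: "\<sigma> i \<le> \<sigma> j" if "r \<le> i" "i \<le> j" "j \<le> e" for i j
    using mono_onD[OF re(5), of i j] that by auto
  have above: "antimono_on {v..} (\<lambda>t. \<Sum>i=r..q. f i t)" if "\<sigma> q \<le> v" for v
    using re ends by (intro prefix_stableD[OF pre]) (auto intro: order_trans[OF mono that])
  consider "\<sigma> q \<le> s" | "q = e" | "s < \<sigma> q" "q < e" using re by linarith
  then show ?thesis
  proof cases
    case 3
    have rest: "mono_on {0..\<sigma> q} (\<lambda>t. \<Sum>i=Suc q..e. f i t)"
      using re ends 3 by (intro suffix_stableD[OF suf]) (auto intro: mono)
    have "antimono_on {s..\<sigma> q} (\<lambda>t. \<Sum>i=r..q. f i t)"
    proof (rule monotone_onI)
      fix x y assume xy: "x \<in> {s..\<sigma> q}" "y \<in> {s..\<sigma> q}" "x \<le> y"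
      have "(\<Sum>i=r..e. f i y) \<le> (\<Sum>i=r..e. f i x)"
        using monotone_onD[OF s(2), of x y] xy by simp
      moreover have "(\<Sum>i=Suc q..e. f i x) \<le> (\<Sum>i=Suc q..e. f i y)"
        using monotone_onD[OF rest, of x y] xy s(1) by simp
      ultimately show "(\<Sum>i=r..q. f i y) \<le> (\<Sum>i=r..q. f i x)"
        using sum_Icc_split[of r q e "\<lambda>i. f i x"] sum_Icc_split[of r q e "\<lambda>i. f i y"] re by simp
    qed
    then show ?thesis using above by (rule antimono_on_atLeast_combine) simp
  qed (use above s in auto)
qed

text \<open>Mirror image: up to \<open>\<sigma> q\<close> the old suffix condition applies, and
  between \<open>\<sigma> q\<close> and \<open>s\<close> the total increases while the part before
  \<open>q\<close> decreases.\<close>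

lemma pooled_suffix_mono:
  assumes pre: "prefix_stable n f \<sigma>" and suf: "suffix_stable n f \<sigma>"
    and re: "1 \<le> r" "r \<le> q" "q \<le> e" "e \<le> n" "mono_on {r..e} \<sigma>"
    and ends: "r = 1 \<or> \<sigma> (r - 1) \<noteq> \<sigma> r" "e = n \<or> \<sigma> (Suc e) \<noteq> \<sigma> e"
    and nonneg: "\<forall>i\<in>{1..n}. 0 \<le> \<sigma> i" and s: "mono_on {0..s} (\<lambda>t. \<Sum>i=r..e. f i t)"
  shows "mono_on {0..s} (\<lambda>t. \<Sum>i=q..e. f i t)"
proof -
  have mono: "\<sigma> i \<le> \<sigma> j" if "r \<le> i" "i \<le> j" "j \<le> e" for i j
    using mono_onD[OF re(5), of i j] that by auto
  have below: "mono_on {0..v} (\<lambda>t. \<Sum>i=q..e. f i t)" if "v \<le> \<sigma> q" for v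
    using re ends by (intro suffix_stableD[OF suf]) (auto intro: order_trans[OF that mono])
  consider "s \<le> \<sigma> q" | "q = r" | "\<sigma> q < s" "r < q" using re by linarith
  then show ?thesis
  proof cases
    case 3
    then obtain m where m: "q = Suc m" "r \<le> m" by (cases q) auto
    have rest: "antimono_on {\<sigma> q..} (\<lambda>t. \<Sum>i=r..m. f i t)"
      using re ends m by (intro prefix_stableD[OF pre]) (auto intro: mono)
    have "mono_on {\<sigma> q..s} (\<lambda>t. \<Sum>i=q..e. f i t)"
    proof (rule monotone_onI)
      fix x y assume xy: "x \<in> {\<sigma> q..s}" "y \<in> {\<sigma> q..s}" "x \<le> y"
      \<comment> \<open>Places \<open>x\<close> and \<open>y\<close> in \<open>{0..s}\<close>, the
        range on which the total is known to increase.\<close>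
      have "0 \<le> \<sigma> q" using nonneg re by auto
      then have "(\<Sum>i=r..e. f i x) \<le> (\<Sum>i=r..e. f i y)"
        using monotone_onD[OF s, of x y] xy by simp
      moreover have "(\<Sum>i=r..m. f i y) \<le> (\<Sum>i=r..m. f i x)"
        using monotone_onD[OF rest, of x y] xy by simp
      ultimately show "(\<Sum>i=q..e. f i x) \<le> (\<Sum>i=q..e. f i y)"
        using sum_Icc_split[of r m e "\<lambda>i. f i x"] sum_Icc_split[of r m e "\<lambda>i. f i y"] re m by simp
    qed
    with below[OF order_refl] show ?thesis by (rule mono_on_atLeastAtMost_combine)
  qed (use below s in auto)
qed

lemma alg_step_runE:
  assumes "alg_step n f \<sigma> \<sigma>'" "\<iota> \<in> maximal_runs n \<sigma>"
  obtains s where "is_arg_max (\<lambda>t. \<Sum>i\<in>\<iota>. f i t) (\<lambda>t. 0 \<le> t) s" "\<forall>i\<in>\<iota>. \<sigma>' i = s"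
proof -
  have "\<forall>\<iota>\<in>maximal_runs n \<sigma>. \<exists>s.
      is_arg_max (\<lambda>t. \<Sum>i\<in>\<iota>. f i t) (\<lambda>t. 0 \<le> t) s \<and> (\<forall>i\<in>\<iota>. \<sigma>' i = s)"
    using assms(1) unfolding alg_step_def by (elim conjE)
  from bspec[OF this assms(2)] that show thesis by (elim exE conjE)
qed

lemma alg_step_outside:
  assumes "alg_step n f \<sigma> \<sigma>'" "i \<notin> \<Union> (maximal_runs n \<sigma>)"
  shows "\<sigma>' i = \<sigma> i"
  using assms unfolding alg_step_def by (elim conjE) simp

lemma alg_step_nonneg:
  assumes "alg_step n f \<sigma> \<sigma>'" "\<forall>i\<in>{1..n}. 0 \<le> \<sigma> i"
  shows "\<forall>i\<in>{1..n}. 0 \<le> \<sigma>' i"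
proof
  fix i assume i: "i \<in> {1..n}"
  show "0 \<le> \<sigma>' i"
  proof (cases "i \<in> \<Union> (maximal_runs n \<sigma>)")
    case True
    then obtain \<iota> where \<iota>: "\<iota> \<in> maximal_runs n \<sigma>" "i \<in> \<iota>" by auto
    obtain s where "is_arg_max (\<lambda>t. \<Sum>i\<in>\<iota>. f i t) (\<lambda>t. 0 \<le> t) s" "\<forall>i\<in>\<iota>. \<sigma>' i = s"
      using assms(1) \<iota>(1) by (rule alg_step_runE)
    then show ?thesis using \<iota>(2) by (simp add: is_arg_max_linorder)
  next
    case False
    then show ?thesis using alg_step_outside[OF assms(1)] assms(2) i by simp
  qed
qed

lemma alg_step_eq_on_run:
  assumes "alg_step n f \<sigma> \<sigma>'" "\<iota> \<in> maximal_runs n \<sigma>" "i \<in> \<iota>" "j \<in> \<iota>"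
  shows "\<sigma>' i = \<sigma>' j"
proof -
  obtain s where "is_arg_max (\<lambda>t. \<Sum>i\<in>\<iota>. f i t) (\<lambda>t. 0 \<le> t) s" "\<forall>i\<in>\<iota>. \<sigma>' i = s"
    using assms(1,2) by (rule alg_step_runE)
  then show ?thesis using assms by simp
qed

text \<open>Lets pooled and untouched indices be treated alike. An index outside all runs has strict
  descents on both sides, so it acts as a run of length one, with its unimodality supplied by the
  two invariants instead of an argmax.\<close>

lemma alg_step_block:
  assumes step: "alg_step n f \<sigma> \<sigma>'" and q: "1 \<le> q" "q \<le> n"
    and conc: "\<And>i. i \<in> {1..n} \<Longrightarrow> concave_on {0..} (f i)"
    and pre: "prefix_stable n f \<sigma>" and suf: "suffix_stable n f \<sigma>"
  obtains r e where "1 \<le> r" "r \<le> q" "q \<le> e" "e \<le> n" "mono_on {r..e} \<sigma>"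
    "r = 1 \<or> \<sigma> (r - 1) \<noteq> \<sigma> r" "e = n \<or> \<sigma> (Suc e) \<noteq> \<sigma> e"
    "\<forall>i\<in>{r..e}. \<sigma>' i = \<sigma>' q"
    "antimono_on {\<sigma>' q..} (\<lambda>t. \<Sum>i=r..e. f i t)" "mono_on {0..\<sigma>' q} (\<lambda>t. \<Sum>i=r..e. f i t)"
proof (cases "q \<in> \<Union> (maximal_runs n \<sigma>)")
  case True
  then obtain \<iota> where \<iota>: "\<iota> \<in> maximal_runs n \<sigma>" "q \<in> \<iota>" by auto
  obtain r e where re: "1 \<le> r" "r < e" "e \<le> n" "\<iota> = {r..e}" "mono_on {r..e} \<sigma>"
    "r = 1 \<or> \<sigma> r < \<sigma> (r - 1)" "e = n \<or> \<sigma> (Suc e) < \<sigma> e"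
    using \<iota>(1) by (rule maximal_runsE)
  obtain s where s: "is_arg_max (\<lambda>t. \<Sum>i\<in>\<iota>. f i t) (\<lambda>t. 0 \<le> t) s" "\<forall>i\<in>\<iota>. \<sigma>' i = s"
    using step \<iota>(1) by (rule alg_step_runE)
  have "concave_on {0..} (\<lambda>t. \<Sum>i=r..e. f i t)"
    using re by (intro sum_concave_on conc) auto
  note unimodal = concave_arg_max_unimodal[OF this s(1)[unfolded re(4)]]
  show thesis
  proof (rule that[of r e])
    have q': "\<sigma>' q = s" using s(2) \<iota>(2) by simp
    show "antimono_on {\<sigma>' q..} (\<lambda>t. \<Sum>i=r..e. f i t)" "mono_on {0..\<sigma>' q} (\<lambda>t. \<Sum>i=r..e. f i t)"
      unfolding q' by (fact unimodal)+
    show "\<forall>i\<in>{r..e}. \<sigma>' i = \<sigma>' q" using s(2) re(4) q' by simp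
    show "r = 1 \<or> \<sigma> (r - 1) \<noteq> \<sigma> r" "e = n \<or> \<sigma> (Suc e) \<noteq> \<sigma> e"
      using re(6,7) by auto
  qed (use re \<iota>(2) in simp_all)
next
  case False
  have "q = 1 \<or> \<sigma> q < \<sigma> (q - 1)"
  proof (rule ccontr)
    assume "\<not> ?thesis"
    then have asc: "1 \<le> q - 1" "q - 1 < n" "\<sigma> (q - 1) \<le> \<sigma> (Suc (q - 1))" and q': "Suc (q - 1) = q"
      using q by auto
    from asc obtain \<iota> where "\<iota> \<in> maximal_runs n \<sigma>" "q - 1 \<in> \<iota>" "Suc (q - 1) \<in> \<iota>"
      by (rule ascent_in_maximal_run)
    then show False using False unfolding q' by blast
  qed
  moreover have "q = n \<or> \<sigma> (Suc q) < \<sigma> q"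
  proof (rule ccontr)
    assume "\<not> ?thesis"
    then have "q < n" "\<sigma> q \<le> \<sigma> (Suc q)" using q by auto
    with q(1) obtain \<iota> where "\<iota> \<in> maximal_runs n \<sigma>" "q \<in> \<iota>" "Suc q \<in> \<iota>"
      by (rule ascent_in_maximal_run)
    then show False using False by blast
  qed
  ultimately have ends: "q = 1 \<or> \<sigma> (q - 1) \<noteq> \<sigma> q" "q = n \<or> \<sigma> (Suc q) \<noteq> \<sigma> q"
    by auto
  have eq: "\<sigma>' q = \<sigma> q" using alg_step_outside[OF step False] .
  show thesis
  proof (rule that[of q q])
    show "antimono_on {\<sigma>' q..} (\<lambda>t. \<Sum>i=q..q. f i t)"
      by (rule prefix_stableD[OF pre q(1) order_refl q(2) ends(1)]) (simp add: eq)
    show "mono_on {0..\<sigma>' q} (\<lambda>t. \<Sum>i=q..q. f i t)"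
      by (rule suffix_stableD[OF suf q(1) order_refl q(2) ends(2)]) (simp add: eq)
  qed (use q ends in \<open>simp_all add: monotone_on_def\<close>)
qed

text \<open>An interval that starts at a boundary of \<open>\<sigma>'\<close> consists of whole
  pieces of the pass and a prefix of a last one. The last piece is handled by pooling, the others by
  induction; pieces that happen to share a new value need no special care.\<close>

lemma alg_step_prefix_stable:
  assumes step: "alg_step n f \<sigma> \<sigma>'"
    and conc: "\<And>i. i \<in> {1..n} \<Longrightarrow> concave_on {0..} (f i)"
    and nonneg: "\<forall>i\<in>{1..n}. 0 \<le> \<sigma> i"
    and pre: "prefix_stable n f \<sigma>" and suf: "suffix_stable n f \<sigma>"
  shows "prefix_stable n f \<sigma>'"
proof -
  have "antimono_on {v..} (\<lambda>t. \<Sum>i=p..q. f i t)"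
    if p: "1 \<le> p" "p = 1 \<or> \<sigma>' (p - 1) \<noteq> \<sigma>' p"
      and q: "p \<le> q" "q \<le> n" "\<forall>i\<in>{p..q}. \<sigma>' i \<le> v" for p q v
    using q
  proof (induction q rule: less_induct)
    case (less q)
    then have q: "1 \<le> q" using p by simp
    obtain r e where re: "1 \<le> r" "r \<le> q" "q \<le> e" "e \<le> n" "mono_on {r..e} \<sigma>"
      and ends: "r = 1 \<or> \<sigma> (r - 1) \<noteq> \<sigma> r" "e = n \<or> \<sigma> (Suc e) \<noteq> \<sigma> e"
      and eq: "\<forall>i\<in>{r..e}. \<sigma>' i = \<sigma>' q"
      and anti: "antimono_on {\<sigma>' q..} (\<lambda>t. \<Sum>i=r..e. f i t)"
      and "mono_on {0..\<sigma>' q} (\<lambda>t. \<Sum>i=r..e. f i t)"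
      using step q less.prems(2) conc pre suf by (rule alg_step_block)
    \<comment> \<open>\<open>\<sigma>'\<close> is constant on a piece, so the boundary at
      \<open>p\<close> cannot lie strictly inside it.\<close>
    have "p \<le> r"
    proof (rule ccontr)
      assume "\<not> p \<le> r"
      then have "p - 1 \<in> {r..e}" "p \<in> {r..e}" using re less.prems by auto
      then have "\<sigma>' (p - 1) = \<sigma>' p" using eq by metis
      then show False using p(2) \<open>\<not> p \<le> r\<close> re(1) by simp
    qed
    have "0 \<le> \<sigma>' q" using alg_step_nonneg[OF step nonneg] q less.prems by auto
    then have "antimono_on {\<sigma>' q..} (\<lambda>t. \<Sum>i=r..q. f i t)"
      using pooled_prefix_antimono[OF pre suf re ends _ anti] by simp
    moreover have "\<sigma>' q \<le> v" using less.prems by auto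
    ultimately have last: "antimono_on {v..} (\<lambda>t. \<Sum>i=r..q. f i t)"
      by (auto intro: monotone_on_subset)
    show ?case
    proof (cases "p = r")
      case False
      then obtain m where m: "r = Suc m" "p \<le> m" using \<open>p \<le> r\<close> by (cases r) auto
      then have "antimono_on {v..} (\<lambda>t. \<Sum>i=p..m. f i t)"
        using less.prems re by (intro less.IH) auto
      with last show ?thesis
        using m re by (simp add: sum_Icc_split[of p m q] monotone_on_def add_mono)
    qed (use last in simp)
  qed
  then show ?thesis unfolding prefix_stable_def by blast
qed

text \<open>The same decomposition read from the other end, with the first piece split off as a
  suffix of a run.\<close>

lemma alg_step_suffix_stable:
  assumes step: "alg_step n f \<sigma> \<sigma>'"
    and conc: "\<And>i. i \<in> {1..n} \<Longrightarrow> concave_on {0..} (f i)"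
    and nonneg: "\<forall>i\<in>{1..n}. 0 \<le> \<sigma> i"
    and pre: "prefix_stable n f \<sigma>" and suf: "suffix_stable n f \<sigma>"
  shows "suffix_stable n f \<sigma>'"
proof -
  have "mono_on {0..v} (\<lambda>t. \<Sum>i=p..q. f i t)"
    if q: "q \<le> n" "q = n \<or> \<sigma>' (Suc q) \<noteq> \<sigma>' q"
      and p: "1 \<le> p" "p \<le> q" "\<forall>i\<in>{p..q}. v \<le> \<sigma>' i" for p q v
    using p
  proof (induction p rule: measure_induct_rule[of "\<lambda>p. n - p"])
    case (less p)
    then have p: "p \<le> n" using q by simp
    obtain r e where re: "1 \<le> r" "r \<le> p" "p \<le> e" "e \<le> n" "mono_on {r..e} \<sigma>"
      and ends: "r = 1 \<or> \<sigma> (r - 1) \<noteq> \<sigma> r" "e = n \<or> \<sigma> (Suc e) \<noteq> \<sigma> e"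
      and eq: "\<forall>i\<in>{r..e}. \<sigma>' i = \<sigma>' p"
      and "antimono_on {\<sigma>' p..} (\<lambda>t. \<Sum>i=r..e. f i t)"
      and mono: "mono_on {0..\<sigma>' p} (\<lambda>t. \<Sum>i=r..e. f i t)"
      using step less.prems(1) p conc pre suf by (rule alg_step_block)
    have "e \<le> q"
    proof (rule ccontr)
      assume "\<not> e \<le> q"
      then have "Suc q \<in> {r..e}" "q \<in> {r..e}" using re less.prems by auto
      then have "\<sigma>' (Suc q) = \<sigma>' q" using eq by metis
      then show False using q(2) \<open>\<not> e \<le> q\<close> re(4) by simp
    qed
    have "mono_on {0..\<sigma>' p} (\<lambda>t. \<Sum>i=p..e. f i t)"
      using pooled_suffix_mono[OF pre suf re ends nonneg mono] .
    moreover have "v \<le> \<sigma>' p" using less.prems by auto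
    ultimately have first: "mono_on {0..v} (\<lambda>t. \<Sum>i=p..e. f i t)"
      by (auto intro: monotone_on_subset)
    show ?case
    proof (cases "e = q")
      case False
      then have "e < q" using \<open>e \<le> q\<close> by simp
      then have "mono_on {0..v} (\<lambda>t. \<Sum>i=Suc e..q. f i t)"
        using less.prems re q by (intro less.IH) auto
      with first show ?thesis
        using \<open>e < q\<close> re by (simp add: sum_Icc_split[of p e q] monotone_on_def add_mono)
    qed (use first in simp)
  qed
  then show ?thesis unfolding suffix_stable_def by blast
qed

lemma alg_reaches_stable:
  assumes "alg_reaches n f \<sigma>0 \<sigma>"
    and conc: "\<And>i. i \<in> {1..n} \<Longrightarrow> concave_on {0..} (f i)"
    and "\<forall>i\<in>{1..n}. 0 \<le> \<sigma>0 i" "prefix_stable n f \<sigma>0" "suffix_stable n f \<sigma>0"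
  shows "(\<forall>i\<in>{1..n}. 0 \<le> \<sigma> i) \<and> prefix_stable n f \<sigma> \<and> suffix_stable n f \<sigma>"
  using assms(1) unfolding alg_reaches_def
proof (induction rule: rtranclp_induct)
  case (step \<sigma> \<sigma>')
  then show ?case
    using alg_step_nonneg[of n f \<sigma> \<sigma>'] alg_step_prefix_stable[of n f \<sigma> \<sigma>', OF _ conc]
      alg_step_suffix_stable[of n f \<sigma> \<sigma>', OF _ conc] by blast
qed (use assms in simp)

section \<open>Optimality of stable valid sequences\<close>

lemma valid_sv_antimono: "valid_sv n \<sigma> \<Longrightarrow> 1 \<le> i \<Longrightarrow> i \<le> j \<Longrightarrow> j \<le> n \<Longrightarrow> \<sigma> j \<le> \<sigma> i"
  using monotone_onD[of "{1..n}" "(\<le>)" "(\<ge>)" \<sigma> i j] by (simp add: valid_sv_def)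

text \<open>The competitor is levelled from the left: the prefix already levelled at
  \<open>u q\<close> descends to \<open>u (Suc q)\<close>, which is still at least \<open>v\<close>,
  so its sum does not decrease.\<close>

lemma prefix_stable_raise_block:
  assumes pre: "prefix_stable n f \<sigma>" and "antimono_on {1..n} u"
    and p: "1 \<le> p" "p = 1 \<or> \<sigma> (p - 1) \<noteq> \<sigma> p"
    and q: "p \<le> q" "q \<le> n" "\<forall>i\<in>{p..q}. \<sigma> i = v \<and> v \<le> u i"
  shows "(\<Sum>i=p..q. f i (u i)) \<le> (\<Sum>i=p..q. f i (u q))"
  using q
proof (induction q rule: dec_induct)
  case (step q)
  have "antimono_on {v..} (\<lambda>t. \<Sum>i=p..q. f i t)"
    using step by (intro prefix_stableD[OF pre p(1) _ _ p(2)]) auto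
  moreover have "u (Suc q) \<le> u q"
    using assms(2) step p(1) by (intro monotone_onD[OF assms(2), of q "Suc q"]) auto
  ultimately have "(\<Sum>i=p..q. f i (u q)) \<le> (\<Sum>i=p..q. f i (u (Suc q)))"
    using step by (intro monotone_onD[of "{v..}" "(\<le>)" "(\<ge>)" "\<lambda>t. \<Sum>i=p..q. f i t"]) auto
  moreover have "(\<Sum>i=p..q. f i (u i)) \<le> (\<Sum>i=p..q. f i (u q))"
    using step.prems by (intro step.IH) auto
  ultimately show ?case using step.hyps by simp
qed simp

text \<open>Levelling from the right: the suffix levelled at \<open>u (Suc p)\<close> rises to
  \<open>u p\<close>, which is still at most \<open>v\<close>.\<close>

lemma suffix_stable_lower_block:
  assumes suf: "suffix_stable n f \<sigma>" and "antimono_on {1..n} u"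
    and q: "q \<le> n" "q = n \<or> \<sigma> (Suc q) \<noteq> \<sigma> q"
    and p: "p \<le> q" "1 \<le> p" "\<forall>i\<in>{p..q}. \<sigma> i = v \<and> 0 \<le> u i \<and> u i \<le> v"
  shows "(\<Sum>i=p..q. f i (u i)) \<le> (\<Sum>i=p..q. f i (u p))"
  using p
proof (induction p rule: inc_induct)
  case (step p)
  have "mono_on {0..v} (\<lambda>t. \<Sum>i=Suc p..q. f i t)"
    using step by (intro suffix_stableD[OF suf _ _ q]) auto
  moreover have "u (Suc p) \<le> u p"
    using assms(2) step q(1) by (intro monotone_onD[OF assms(2), of p "Suc p"]) auto
  ultimately have "(\<Sum>i=Suc p..q. f i (u (Suc p))) \<le> (\<Sum>i=Suc p..q. f i (u p))"
    using step by (intro monotone_onD[of "{0..v}" "(\<le>)" "(\<le>)" "\<lambda>t. \<Sum>i=Suc p..q. f i t"]) auto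
  moreover have "(\<Sum>i=Suc p..q. f i (u i)) \<le> (\<Sum>i=Suc p..q. f i (u (Suc p)))"
    using step.prems by (intro step.IH) auto
  ultimately show ?case using step.hyps by (simp add: sum.atLeast_Suc_atMost)
qed simp

text \<open>Blocks are peeled off from the right. On each, the competitor is first levelled at
  \<open>u q\<close> and then lowered to \<open>\<sigma> q\<close>; neither move loses
  anything.\<close>

lemma prefix_stable_raise:
  assumes pre: "prefix_stable n f \<sigma>" and \<sigma>: "valid_sv n \<sigma>"
    and u: "antimono_on {1..n} u" "\<forall>i\<in>{1..n}. \<sigma> i \<le> u i" and "q \<le> n"
  shows "(\<Sum>i=1..q. f i (u i)) \<le> (\<Sum>i=1..q. f i (\<sigma> i))"
  using \<open>q \<le> n\<close>
proof (induction q rule: less_induct)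
  case (less q)
  show ?case
  proof (cases "q = 0")
    case False
    \<comment> \<open>Equal values of an antitone sequence are contiguous, so the least index with
      value \<open>\<sigma> q\<close> starts its block; \<open>1 \<le> p\<close> keeps the
      meaningless index 0 out.\<close>
    define p where "p = (LEAST p. 1 \<le> p \<and> \<sigma> p = \<sigma> q)"
    have p: "1 \<le> p" "\<sigma> p = \<sigma> q"
      using LeastI[of "\<lambda>p. 1 \<le> p \<and> \<sigma> p = \<sigma> q" q] False unfolding p_def by auto
    have "p \<le> q" unfolding p_def by (rule Least_le) (use False in simp)
    have start: "p = 1 \<or> \<sigma> (p - 1) \<noteq> \<sigma> p"
      using not_less_Least[of "p - 1" "\<lambda>p. 1 \<le> p \<and> \<sigma> p = \<sigma> q"] p unfolding p_def[symmetric]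
      by force
    have const: "\<sigma> i = \<sigma> q" if "i \<in> {p..q}" for i
      using valid_sv_antimono[OF \<sigma>, of p i] valid_sv_antimono[OF \<sigma>, of i q] that p less.prems
      by auto
    have "(\<Sum>i=p..q. f i (u i)) \<le> (\<Sum>i=p..q. f i (u q))"
    proof (rule prefix_stable_raise_block[OF pre u(1) p(1) start \<open>p \<le> q\<close> less.prems], intro ballI conjI)
      fix i assume i: "i \<in> {p..q}"
      show "\<sigma> i = \<sigma> q" using i by (rule const)
      moreover have "\<sigma> i \<le> u i" using u(2) i p(1) less.prems by auto
      ultimately show "\<sigma> q \<le> u i" by simp
    qed
    also have "\<dots> \<le> (\<Sum>i=p..q. f i (\<sigma> q))"
    proof -
      have "antimono_on {\<sigma> q..} (\<lambda>t. \<Sum>i=p..q. f i t)"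
        by (rule prefix_stableD[OF pre p(1) \<open>p \<le> q\<close> less.prems start]) (rule eq_refl[OF const], simp)
      moreover have "\<sigma> q \<le> u q" using u(2) False less.prems by auto
      ultimately show ?thesis by (auto dest: monotone_onD)
    qed
    also have "\<dots> = (\<Sum>i=p..q. f i (\<sigma> i))"
      using const by (intro sum.cong) metis+
    finally have block: "(\<Sum>i=p..q. f i (u i)) \<le> (\<Sum>i=p..q. f i (\<sigma> i))" .
    obtain m where m: "p = Suc m" using p(1) by (cases p) auto
    moreover have "(\<Sum>i=1..m. f i (u i)) \<le> (\<Sum>i=1..m. f i (\<sigma> i))"
      using m \<open>p \<le> q\<close> less.prems by (intro less.IH) auto
    ultimately show ?thesis
      using block \<open>p \<le> q\<close> sum_Icc_split[of 1 m q "\<lambda>i. f i (u i)"]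
        sum_Icc_split[of 1 m q "\<lambda>i. f i (\<sigma> i)"] by simp
  qed simp
qed

lemma suffix_stable_lower:
  assumes suf: "suffix_stable n f \<sigma>" and \<sigma>: "valid_sv n \<sigma>"
    and u: "antimono_on {1..n} u" "\<forall>i\<in>{1..n}. 0 \<le> u i \<and> u i \<le> \<sigma> i" and "1 \<le> p"
  shows "(\<Sum>i=p..n. f i (u i)) \<le> (\<Sum>i=p..n. f i (\<sigma> i))"
  using \<open>1 \<le> p\<close>
\<comment> \<open>The measure needs \<open>Suc n\<close>: when the last block ends at
  \<open>n\<close>, the induction hypothesis is used at \<open>Suc n\<close>, and
  \<open>n - p\<close> would not decrease from \<open>p = n\<close>.\<close>
proof (induction p rule: measure_induct_rule[of "\<lambda>p. Suc n - p"])
  case (less p)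
  show ?case
  proof (cases "p \<le> n")
    case True
    define q where "q = (GREATEST q. q \<le> n \<and> \<sigma> q = \<sigma> p)"
    have q: "q \<le> n" "\<sigma> q = \<sigma> p"
      using GreatestI_nat[of "\<lambda>q. q \<le> n \<and> \<sigma> q = \<sigma> p" p n] True unfolding q_def by auto
    have "p \<le> q" unfolding q_def by (rule Greatest_le_nat[of _ _ n]) (use True in auto)
    have stop: "q = n \<or> \<sigma> (Suc q) \<noteq> \<sigma> q"
    proof (rule ccontr)
      assume "\<not> ?thesis"
      then have "Suc q \<le> n \<and> \<sigma> (Suc q) = \<sigma> p" using q by auto
      then have "Suc q \<le> q" unfolding q_def by (rule Greatest_le_nat[of _ _ n]) simp
      then show False by simp
    qed
    have const: "\<sigma> i = \<sigma> p" if "i \<in> {p..q}" for i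
      using valid_sv_antimono[OF \<sigma>, of p i] valid_sv_antimono[OF \<sigma>, of i q] that q less.prems
      by auto
    have "(\<Sum>i=p..q. f i (u i)) \<le> (\<Sum>i=p..q. f i (u p))"
    proof (rule suffix_stable_lower_block[OF suf u(1) q(1) stop \<open>p \<le> q\<close> less.prems], intro ballI conjI)
      fix i assume i: "i \<in> {p..q}"
      show "\<sigma> i = \<sigma> p" using i by (rule const)
      moreover have "0 \<le> u i \<and> u i \<le> \<sigma> i" using u(2) i q(1) less.prems by auto
      ultimately show "0 \<le> u i" "u i \<le> \<sigma> p" by simp_all
    qed
    also have "\<dots> \<le> (\<Sum>i=p..q. f i (\<sigma> p))"
    proof -
      have mono: "mono_on {0..\<sigma> p} (\<lambda>t. \<Sum>i=p..q. f i t)"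
        by (rule suffix_stableD[OF suf less.prems \<open>p \<le> q\<close> q(1) stop])
          (rule eq_refl[OF const[symmetric]], simp)
      have "0 \<le> u p" "u p \<le> \<sigma> p" using u(2) True less.prems by auto
      then show ?thesis using monotone_onD[OF mono, of "u p" "\<sigma> p"] by simp
    qed
    also have "\<dots> = (\<Sum>i=p..q. f i (\<sigma> i))"
      using const by (intro sum.cong) metis+
    finally have block: "(\<Sum>i=p..q. f i (u i)) \<le> (\<Sum>i=p..q. f i (\<sigma> i))" .
    moreover have "(\<Sum>i=Suc q..n. f i (u i)) \<le> (\<Sum>i=Suc q..n. f i (\<sigma> i))"
      using \<open>p \<le> q\<close> True by (intro less.IH) auto
    ultimately show ?thesis
      using \<open>p \<le> q\<close> q(1) sum_Icc_split[of p q n "\<lambda>i. f i (u i)"]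
        sum_Icc_split[of p q n "\<lambda>i. f i (\<sigma> i)"] by simp
  qed simp
qed

text \<open>Since \<open>{f (max x y), f (min x y)} = {f x, f y}\<close>, a competitor \<open>z\<close> can be compared
  through its join and its meet with \<open>\<sigma>\<close>, which only raise, respectively lower, \<open>\<sigma>\<close>.\<close>

lemma stable_valid_optimal:
  assumes pre: "prefix_stable n f \<sigma>" and suf: "suffix_stable n f \<sigma>" and \<sigma>: "valid_sv n \<sigma>"
  shows "is_arg_max (\<lambda>z. \<Sum>i=1..n. f i (z i)) (valid_sv n) \<sigma>"
  unfolding is_arg_max_linorder
proof (intro conjI allI impI \<sigma>)
  fix z assume z: "valid_sv n z"
  have "antimono_on {1..n} (\<lambda>i. max (z i) (\<sigma> i))"
  proof (rule monotone_onI)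
    fix i j :: nat assume "i \<in> {1..n}" "j \<in> {1..n}" "i \<le> j"
    then show "max (z j) (\<sigma> j) \<le> max (z i) (\<sigma> i)"
      by (intro max.mono valid_sv_antimono[OF z] valid_sv_antimono[OF \<sigma>]) auto
  qed
  then have up: "(\<Sum>i=1..n. f i (max (z i) (\<sigma> i))) \<le> (\<Sum>i=1..n. f i (\<sigma> i))"
    by (intro prefix_stable_raise[OF pre \<sigma>]) auto
  have "antimono_on {1..n} (\<lambda>i. min (z i) (\<sigma> i))"
  proof (rule monotone_onI)
    fix i j :: nat assume "i \<in> {1..n}" "j \<in> {1..n}" "i \<le> j"
    then show "min (z j) (\<sigma> j) \<le> min (z i) (\<sigma> i)"
      by (intro min.mono valid_sv_antimono[OF z] valid_sv_antimono[OF \<sigma>]) auto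
  qed
  then have down: "(\<Sum>i=1..n. f i (min (z i) (\<sigma> i))) \<le> (\<Sum>i=1..n. f i (\<sigma> i))"
    using z \<sigma> by (intro suffix_stable_lower[OF suf \<sigma>]) (auto simp: valid_sv_def)
  have "(\<Sum>i=1..n. f i (z i)) + (\<Sum>i=1..n. f i (\<sigma> i))
      = (\<Sum>i=1..n. f i (max (z i) (\<sigma> i))) + (\<Sum>i=1..n. f i (min (z i) (\<sigma> i)))"
    unfolding sum.distrib[symmetric] by (rule sum.cong) (auto simp: max_def min_def)
  with up down show "(\<Sum>i=1..n. f i (z i)) \<le> (\<Sum>i=1..n. f i (\<sigma> i))" by linarith
qed

section \<open>Execution of the algorithm\<close>

lemma sum_attains_max:
  fixes f :: "'i \<Rightarrow> real \<Rightarrow> real"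
  assumes "finite A" and cont: "\<And>i. i \<in> A \<Longrightarrow> continuous_on UNIV (f i)"
    and c: "\<And>i. i \<in> A \<Longrightarrow> 0 \<le> c i" and anti: "\<And>i. i \<in> A \<Longrightarrow> antimono_on {c i..} (f i)"
  obtains s where "is_arg_max (\<lambda>t. \<Sum>i\<in>A. f i t) (\<lambda>t. 0 \<le> t) s"
proof -
  let ?F = "\<lambda>t. \<Sum>i\<in>A. f i t"
  \<comment> \<open>All \<open>c i\<close> are nonnegative, so their sum bounds each of them, also
    for empty \<open>A\<close>. Beyond \<open>M\<close> every summand decreases, and the compact
    interval \<open>{0..M}\<close> decides.\<close>
  define M where "M = sum c A"
  have M: "0 \<le> M" unfolding M_def using c by (rule sum_nonneg)
  have cM: "c i \<le> M" if "i \<in> A" for i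
    unfolding M_def using c that \<open>finite A\<close> by (intro member_le_sum) auto
  have "continuous_on {0..M} ?F"
    by (intro continuous_on_sum continuous_on_subset[OF cont]) auto
  then obtain s where s: "s \<in> {0..M}" "\<And>t. t \<in> {0..M} \<Longrightarrow> ?F t \<le> ?F s"
    using continuous_attains_sup[of "{0..M}" ?F] M by auto
  have "?F t \<le> ?F s" if "0 \<le> t" for t
  proof (cases "t \<le> M")
    case False
    then have "?F t \<le> ?F M"
      using cM by (intro sum_mono monotone_onD[OF anti]) force+
    also have "?F M \<le> ?F s" using s M by auto
    finally show ?thesis .
  qed (use s that in auto)
  then show thesis using s by (intro that[of s]) (auto simp: is_arg_max_linorder)
qed

text \<open>One argmax is chosen per run, then spread over its indices; disjointness of maximal runs
  makes \<open>run\<close> unambiguous.\<close>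

lemma alg_step_exists:
  assumes "\<not> valid_sv n \<sigma>"
    and attained: "\<And>A. A \<subseteq> {1..n} \<Longrightarrow> \<exists>s. is_arg_max (\<lambda>t. \<Sum>i\<in>A. f i t) (\<lambda>t. 0 \<le> t) s"
  shows "\<exists>\<sigma>'. alg_step n f \<sigma> \<sigma>'"
proof -
  let ?R = "maximal_runs n \<sigma>"
  have sub: "\<iota> \<subseteq> {1..n}" if "\<iota> \<in> ?R" for \<iota>
    using that by (auto elim!: maximal_runsE)
  define val where "val \<iota> = (SOME s. is_arg_max (\<lambda>t. \<Sum>i\<in>\<iota>. f i t) (\<lambda>t. 0 \<le> t) s)" for \<iota>
  define run where "run i = (THE \<iota>. \<iota> \<in> ?R \<and> i \<in> \<iota>)" for i
  define \<sigma>' where "\<sigma>' i = (if i \<in> \<Union> ?R then val (run i) else \<sigma> i)" for i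
  have run: "run i = \<iota>" if "\<iota> \<in> ?R" "i \<in> \<iota>" for i \<iota>
    unfolding run_def using that maximal_runs_disjoint by (intro the_equality) blast+
  have "\<exists>s. is_arg_max (\<lambda>t. \<Sum>i\<in>\<iota>. f i t) (\<lambda>t. 0 \<le> t) s \<and> (\<forall>i\<in>\<iota>. \<sigma>' i = s)"
    if \<iota>: "\<iota> \<in> ?R" for \<iota>
  proof (intro exI conjI ballI)
    show "is_arg_max (\<lambda>t. \<Sum>i\<in>\<iota>. f i t) (\<lambda>t. 0 \<le> t) (val \<iota>)"
      unfolding val_def by (rule someI_ex) (rule attained[OF sub[OF \<iota>]])
    fix i assume "i \<in> \<iota>"
    then show "\<sigma>' i = val \<iota>" using run[OF \<iota>] \<iota> by (auto simp: \<sigma>'_def)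
  qed
  then have "alg_step n f \<sigma> \<sigma>'"
    unfolding alg_step_def using assms(1) by (simp add: \<sigma>'_def)
  then show ?thesis by blast
qed

section \<open>Termination\<close>

definition changes :: "nat \<Rightarrow> (nat \<Rightarrow> real) \<Rightarrow> nat set" where
  "changes n \<sigma> = {i. 1 \<le> i \<and> i < n \<and> \<sigma> i \<noteq> \<sigma> (Suc i)}"

text \<open>With nonnegative entries, only a strict ascent can make the sequence invalid. All
  changes are counted, not ascents alone, since a descent at the edge of a run may turn into a new
  ascent.\<close>

lemma alg_step_changes:
  assumes step: "alg_step n f \<sigma> \<sigma>'" and nonneg: "\<forall>i\<in>{1..n}. 0 \<le> \<sigma> i"
  shows "card (changes n \<sigma>') < card (changes n \<sigma>)"
proof -
  have pooled: "\<sigma>' i = \<sigma>' (Suc i)" if i: "1 \<le> i" "i < n" "\<sigma> i \<le> \<sigma> (Suc i)" for i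
  proof -
    obtain \<iota> where "\<iota> \<in> maximal_runs n \<sigma>" "i \<in> \<iota>" "Suc i \<in> \<iota>"
      using i by (rule ascent_in_maximal_run)
    then show ?thesis by (rule alg_step_eq_on_run[OF step])
  qed
  have "\<exists>i. 1 \<le> i \<and> i < n \<and> \<sigma> i < \<sigma> (Suc i)"
  proof (rule ccontr)
    assume "\<not> ?thesis"
    then have desc: "\<sigma> (Suc i) \<le> \<sigma> i" if "1 \<le> i" "i < n" for i
      using that by (meson not_le)
    have "antimono_on {1..n} \<sigma>"
    proof (rule monotone_onI)
      fix i j assume "i \<in> {1..n}" "j \<in> {1..n}" "i \<le> j"
      from \<open>i \<le> j\<close> \<open>j \<in> {1..n}\<close> show "\<sigma> j \<le> \<sigma> i"
      proof (induction j rule: dec_induct)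
        case (step j)
        then have "\<sigma> (Suc j) \<le> \<sigma> j" "\<sigma> j \<le> \<sigma> i"
          using \<open>i \<in> {1..n}\<close> by (auto intro: desc)
        then show ?case by simp
      qed simp
    qed
    then have "valid_sv n \<sigma>" using nonneg by (simp add: valid_sv_def)
    then show False using step by (simp add: alg_step_def)
  qed
  then obtain i where i: "1 \<le> i" "i < n" "\<sigma> i < \<sigma> (Suc i)" by blast
  have "changes n \<sigma>' \<subseteq> changes n \<sigma>" unfolding changes_def using pooled by force
  moreover have "i \<in> changes n \<sigma>" "i \<notin> changes n \<sigma>'"
    using i pooled[of i] by (auto simp: changes_def)
  ultimately have "changes n \<sigma>' \<subset> changes n \<sigma>" by blast
  moreover have "finite (changes n \<sigma>)"
    by (rule finite_subset[of _ "{..<n}"]) (auto simp: changes_def)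
  ultimately show ?thesis by (rule psubset_card_mono[rotated])
qed

lemma no_infinite_execution:
  assumes "\<forall>i\<in>{1..n}. 0 \<le> X 0 i" "\<forall>k. alg_step n f (X k) (X (Suc k))"
  shows False
proof -
  have nonneg: "\<forall>i\<in>{1..n}. 0 \<le> X k i" for k
  proof (induction k)
    case (Suc k)
    show ?case by (rule alg_step_nonneg[OF spec[OF assms(2)] Suc])
  qed (rule assms(1))
  have "card (changes n (X k)) + k \<le> card (changes n (X 0))" for k
  proof (induction k)
    case (Suc k)
    then show ?case using alg_step_changes[OF spec[OF assms(2)] nonneg, of k] by linarith
  qed simp
  from this[of "Suc (card (changes n (X 0)))"] show False by simp
qed

lemma terminates_imp_output:
  assumes "alg_terminates n f \<sigma>0"
  shows "\<exists>\<sigma>. alg_output n f \<sigma>0 \<sigma>"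
proof (rule ccontr)
  assume none: "\<not> ?thesis"
  \<comment> \<open>Dependent choice controls the start only through the predicate, so the clause
    for \<open>k = 0\<close> pins it to \<open>\<sigma>0\<close>. Without an output every reachable
    state is invalid and has a successor, which would give an infinite execution.\<close>
  let ?P = "\<lambda>k \<sigma>. alg_reaches n f \<sigma>0 \<sigma> \<and> (k = (0::nat) \<longrightarrow> \<sigma> = \<sigma>0)"
  have "\<exists>X. \<forall>k. ?P k (X k) \<and> alg_step n f (X k) (X (Suc k))"
  proof (rule dependent_nat_choice)
    show "\<exists>\<sigma>. ?P 0 \<sigma>" by (auto simp: alg_reaches_def)
    fix \<sigma> k assume \<sigma>: "?P k \<sigma>"
    then have "\<not> valid_sv n \<sigma>" using none by (auto simp: alg_output_def)
    then obtain \<sigma>' where "alg_step n f \<sigma> \<sigma>'" using \<sigma> assms by (auto simp: alg_terminates_def)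
    then show "\<exists>\<sigma>'. ?P (Suc k) \<sigma>' \<and> alg_step n f \<sigma> \<sigma>'"
      using \<sigma> unfolding alg_reaches_def by (metis nat.simps(3) rtranclp.rtrancl_into_rtrancl)
  qed
  then obtain X where "\<forall>k. ?P k (X k) \<and> alg_step n f (X k) (X (Suc k))" ..
  then have "X 0 = \<sigma>0" "\<forall>k. alg_step n f (X k) (X (Suc k))" by blast+
  then show False using assms unfolding alg_terminates_def by blast
qed

theorem mainTheorem3:
  fixes n :: nat and \<rho> :: real and a b y s :: "nat \<Rightarrow> real" and f :: "nat \<Rightarrow> real \<Rightarrow> real"
  assumes "n \<ge> 1" and "\<rho> > 0"
    and "mono_on {1..n} a" and "\<forall>i\<in>{1..n}. 0 \<le> a i"
    and "mono_on {1..n} b" and "\<forall>i\<in>{1..n}. 0 \<le> b i"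
    and "valid_sv n y"
    and f: "\<And>i t. f i t = prox_summand \<rho> (a i) (b i) (y i) t"
    and s: "\<And>i. s i = indiv_maximizer \<rho> (a i) (b i) (y i)"
  shows "(\<forall>i\<in>{1..n}. {t. is_arg_max (f i) (\<lambda>t. 0 \<le> t) t} = {s i}) \<and>
         alg_terminates n f s \<and>
         (\<exists>\<sigma>. alg_output n f s \<sigma>) \<and>
         (\<forall>\<sigma>. alg_output n f s \<sigma> \<longrightarrow>
            is_arg_max (\<lambda>z. \<Sum>i=1..n. f i (z i)) (valid_sv n) \<sigma>)"
proof -
  have f_eq: "f i = prox_summand \<rho> (a i) (b i) (y i)" for i
    by (rule ext) (rule f)
  have params: "0 \<le> a i" "0 \<le> b i" "0 \<le> y i" if "i \<in> {1..n}" for i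
    using that assms(4,6,7) by (auto simp: valid_sv_def)
  have argmax: "is_arg_max (f i) (\<lambda>t. 0 \<le> t) t \<longleftrightarrow> t = s i" if "i \<in> {1..n}" for i t
    unfolding f_eq s using \<open>\<rho> > 0\<close> params[OF that] by (rule is_arg_max_prox_summand_iff)
  have nonneg: "\<forall>i\<in>{1..n}. 0 \<le> s i"
    unfolding s by (intro ballI indiv_maximizer_nonneg \<open>\<rho> > 0\<close> params)
  have conc: "concave_on {0..} (f i)" for i
    unfolding f_eq using \<open>\<rho> > 0\<close> by (rule concave_on_prox_summand)
  \<comment> \<open>The individual argmax and concavity give the base case of both invariants and
    the bounds beyond which the pooled sums decrease.\<close>
  have unimodal: "mono_on {0..s i} (f i)" "antimono_on {s i..} (f i)" if "i \<in> {1..n}" for i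
    using concave_arg_max_unimodal[OF conc] argmax[OF that] by blast+
  have pre: "prefix_stable n f s" and suf: "suffix_stable n f s"
    using unimodal by (blast intro: initial_prefix_stable initial_suffix_stable)+
  have attained: "\<exists>t. is_arg_max (\<lambda>t. \<Sum>i\<in>A. f i t) (\<lambda>t. 0 \<le> t) t" if "A \<subseteq> {1..n}" for A
  proof -
    show ?thesis
    proof (rule sum_attains_max[of A f s])
      show "finite A" using that by (rule finite_subset) simp
      show "continuous_on UNIV (f i)" for i unfolding f_eq by (rule continuous_on_prox_summand)
      show "0 \<le> s i" "antimono_on {s i..} (f i)" if "i \<in> A" for i
        using nonneg unimodal(2) \<open>A \<subseteq> {1..n}\<close> that by blast+
    qed blast
  qed
  have terminates: "alg_terminates n f s"
    unfolding alg_terminates_def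
    using no_infinite_execution[of n _ f] nonneg alg_step_exists[OF _ attained] by blast
  have "is_arg_max (\<lambda>z. \<Sum>i=1..n. f i (z i)) (valid_sv n) \<sigma>" if "alg_output n f s \<sigma>" for \<sigma>
    using that alg_reaches_stable[OF _ conc nonneg pre suf] stable_valid_optimal
    unfolding alg_output_def by blast
  then show ?thesis
    using argmax terminates terminates_imp_output[OF terminates] by auto
qed

end
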